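(* Let $(v(x,t),b(x,t))$ be a smooth solution on $\mathbb{R}^3\times[0,T)$, $T\in(0,\infty]$, of the ideal magnetohydrodynamic equations $$\frac{\partial v}{\partial t}+(v\cdot\nabla)v=-\nabla p-b\times\operatorname{curl}b,\qquad\frac{\partial b}{\partial t}+(v\cdot\nabla)b=(b\cdot\nabla)v,\qquad\operatorname{div}v=\operatorname{div}b=0,$$ $v(x,0)=v_0(x)$, $b(x,0)=b_0(x)$, and let $\{X(\cdot,t)\}$ be the particle trajectory map generated by $v$. Let $\{\gamma_0(s)\}_{s\in I}$ be an integral curve of the initial magnetic field $b_0$, and set $\gamma(s,t)=X(\gamma_0(s),t)$ (which is also an integral curve of the magnetic field $b(\cdot,t)$). Then, for all $s\in I$ and $t\in[0,T)$, $$\frac{|b(\gamma(s,t),t)|}{\left|\frac{\partial\gamma(s,t)}{\partial s}\right|}=\frac{|b_0(\gamma_0(s))|}{\left|\frac{\partial\gamma_0(s)}{\partial s}\right|}.$$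
   Context: $v=(v_1,v_2,v_3)$ is the velocity, $p=p(x,t)$ the scalar pressure, $b=(b_1,b_2,b_3)$ the magnetic field, and $\operatorname{div}v_0=\operatorname{div}b_0=0$. The particle trajectory map $X(\cdot,t)$ generated by $v$ is defined by $\frac{\partial X(a,t)}{\partial t}=v(X(a,t),t)$, $X(a,0)=a\in\mathbb{R}^3$; for each $t\in[0,T)$ it is a diffeomorphism of $\mathbb{R}^3$ (standing assumption). Integral curves are understood up to reparametrization: a smooth curve $\{\gamma(s)\}_{s\in I}$ ($I\subset\mathbb{R}$ an interval) with $\frac{\partial\gamma}{\partial s}\neq0$ on $I$ is an integral curve of a vector field $V$ if there is a function $f$ on $I$ with $f(s)\ne0$ and $\frac{\partial\gamma}{\partial s}(s)=f(s)V(\gamma(s))$ for all $s\in I$. *)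

theory Defs
  imports "HOL-Analysis.Analysis"
begin

(* Derivatives are taken within S, so they are one-sided at boundary points of S. They are
   uniquely determined on the sets used below (convex sets with nonempty interior). *)
primrec C_k_on :: "nat \<Rightarrow> ('a::real_normed_vector \<Rightarrow> 'b::real_normed_vector) \<Rightarrow> 'a set \<Rightarrow> bool"
where
  "C_k_on 0 f S \<longleftrightarrow> continuous_on S f"
| "C_k_on (Suc k) f S \<longleftrightarrow> f differentiable_on S \<and>
     (\<forall>h. C_k_on k (\<lambda>x. frechet_derivative f (at x within S) h) S)"

definition smooth_on :: "('a::real_normed_vector \<Rightarrow> 'b::real_normed_vector) \<Rightarrow> 'a set \<Rightarrow> bool"
  where "smooth_on f S \<longleftrightarrow> (\<forall>k. C_k_on k f S)"

definition diffeomorphism :: "('a::real_normed_vector \<Rightarrow> 'b::real_normed_vector) \<Rightarrow> bool"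
  where "diffeomorphism F \<longleftrightarrow> bij F \<and> smooth_on F UNIV \<and> smooth_on (inv F) UNIV"

definition partial_deriv :: "3 \<Rightarrow> (real^3 \<Rightarrow> 'b::real_normed_vector) \<Rightarrow> real^3 \<Rightarrow> 'b"
  where "partial_deriv j f x = vector_derivative (\<lambda>h. f (x + h *\<^sub>R axis j 1)) (at 0)"

definition gradient :: "(real^3 \<Rightarrow> real) \<Rightarrow> real^3 \<Rightarrow> real^3"
  where "gradient f x = (\<chi> j. partial_deriv j f x)"

definition divergence :: "(real^3 \<Rightarrow> real^3) \<Rightarrow> real^3 \<Rightarrow> real"
  where "divergence u x = (\<Sum>j\<in>UNIV. partial_deriv j (\<lambda>y. u y $ j) x)"

definition curl :: "(real^3 \<Rightarrow> real^3) \<Rightarrow> real^3 \<Rightarrow> real^3"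
  where "curl u x = vector
    [partial_deriv 2 (\<lambda>y. u y $ 3) x - partial_deriv 3 (\<lambda>y. u y $ 2) x,
     partial_deriv 3 (\<lambda>y. u y $ 1) x - partial_deriv 1 (\<lambda>y. u y $ 3) x,
     partial_deriv 1 (\<lambda>y. u y $ 2) x - partial_deriv 2 (\<lambda>y. u y $ 1) x]"

(* (w . nabla) u *)
definition advect :: "(real^3 \<Rightarrow> real^3) \<Rightarrow> (real^3 \<Rightarrow> real^3) \<Rightarrow> real^3 \<Rightarrow> real^3"
  where "advect w u x = (\<Sum>j\<in>UNIV. (w x $ j) *\<^sub>R partial_deriv j u x)"

(* [0,T), where T may be infinite *)
definition time_dom :: "ereal \<Rightarrow> real set"
  where "time_dom T = {t. 0 \<le> t \<and> ereal t < T}"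

(* One-sided at t = 0. *)
definition time_deriv :: "ereal \<Rightarrow> (real^3 \<Rightarrow> real \<Rightarrow> real^3) \<Rightarrow> real^3 \<Rightarrow> real \<Rightarrow> real^3"
  where "time_deriv T u x t = vector_derivative (u x) (at t within time_dom T)"

(* Only differentiability in space is asked of the pressure: the momentum equation then makes its
   gradient smooth, while p itself is determined only up to a function of time. *)
definition smooth_ideal_mhd_solution ::
  "ereal \<Rightarrow> (real^3 \<Rightarrow> real \<Rightarrow> real^3) \<Rightarrow> (real^3 \<Rightarrow> real \<Rightarrow> real^3) \<Rightarrow> (real^3 \<Rightarrow> real \<Rightarrow> real) \<Rightarrow> bool"
where
  "smooth_ideal_mhd_solution T v b p \<longleftrightarrow>
     smooth_on (\<lambda>(x, t). v x t) (UNIV \<times> time_dom T) \<and>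
     smooth_on (\<lambda>(x, t). b x t) (UNIV \<times> time_dom T) \<and>
     (\<forall>t\<in>time_dom T. (\<lambda>x. p x t) differentiable_on UNIV) \<and>
     (\<forall>x. \<forall>t\<in>time_dom T.
        time_deriv T v x t + advect (\<lambda>y. v y t) (\<lambda>y. v y t) x
          = - gradient (\<lambda>y. p y t) x - cross3 (b x t) (curl (\<lambda>y. b y t) x) \<and>
        time_deriv T b x t + advect (\<lambda>y. v y t) (\<lambda>y. b y t) x
          = advect (\<lambda>y. b y t) (\<lambda>y. v y t) x \<and>
        divergence (\<lambda>y. v y t) x = 0 \<and>
        divergence (\<lambda>y. b y t) x = 0)"

definition particle_trajectory_map ::
  "ereal \<Rightarrow> (real^3 \<Rightarrow> real \<Rightarrow> real^3) \<Rightarrow> (real^3 \<Rightarrow> real \<Rightarrow> real^3) \<Rightarrow> bool"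
where
  "particle_trajectory_map T v X \<longleftrightarrow>
     (\<forall>a. X a 0 = a) \<and>
     (\<forall>a. \<forall>t\<in>time_dom T. (X a has_vector_derivative v (X a t) t) (at t within time_dom T)) \<and>
     (\<forall>t\<in>time_dom T. diffeomorphism (\<lambda>a. X a t))"

(* The interval I may be open, closed or half-open, bounded or not; it must be nondegenerate for
   the derivative of the curve to be meaningful. *)
definition integral_curve :: "(real^3 \<Rightarrow> real^3) \<Rightarrow> real set \<Rightarrow> (real \<Rightarrow> real^3) \<Rightarrow> bool"
where
  "integral_curve V I c \<longleftrightarrow>
     is_interval I \<and> interior I \<noteq> {} \<and> smooth_on c I \<and>
     (\<forall>s\<in>I. vector_derivative c (at s within I) \<noteq> 0) \<and>
     (\<exists>f::real \<Rightarrow> real. \<forall>s\<in>I. f s \<noteq> 0 \<and>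
        vector_derivative c (at s within I) = f s *\<^sub>R V (c s))"

end

theory Submission
  imports Defs
begin

text \<open>Along a particle path, both b(X(a,t),t) and the derivative of X(.,t) at a applied to
  b0(a) satisfy the linearized flow equation w' = Dv(X(a,t),t) w with the same initial value,
  hence they agree. If the derivative of the initial curve is f(s) b0, that of the transported
  curve is therefore f(s) b with the same factor f, and both quotients equal 1 / |f(s)|.
  Smoothness of X in a is known for each fixed t only, so the linearized equation is obtained
  from a Gronwall estimate for X(a + e b0(a), t) - X(a, t) - e w(t) and not by exchanging derivatives.\<close>

subsection \<open>Functions of class C^k on perfect subsets of the line\<close>

text \<open>Derivatives within \<open>S\<close> at points of \<open>S\<close> see only values on
  \<open>S\<close>. Hence \<open>f\<close> and \<open>g\<close> admit the same derivatives there,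
  and \<open>frechet_derivative\<close>, a choice among these, picks the same one even where it is
  not unique.\<close>

lemma C_k_on_cong:
  assumes "\<And>x. x \<in> S \<Longrightarrow> f x = g x"
  shows "C_k_on k f S \<longleftrightarrow> C_k_on k g S"
  using assms
proof (induction k arbitrary: f g)
  case 0
  then show ?case
    using continuous_on_cong[of S S f g] by simp
next
  case (Suc k)
  have D: "(f has_derivative D) (at x within S) \<longleftrightarrow> (g has_derivative D) (at x within S)"
    if "x \<in> S" for x D
    using Suc.prems that by (metis has_derivative_transform)
  then have "C_k_on k (\<lambda>x. frechet_derivative f (at x within S) h) S \<longleftrightarrow>
             C_k_on k (\<lambda>x. frechet_derivative g (at x within S) h) S" for h
    by (intro Suc.IH) (simp add: frechet_derivative_def)
  then show ?case
    using D by (simp add: differentiable_on_def differentiable_def)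
qed

lemma C_k_on_Suc_imp: "C_k_on (Suc k) f S \<Longrightarrow> C_k_on k f S"
proof (induction k arbitrary: f)
  case 0
  then show ?case
    by (simp add: differentiable_imp_continuous_on)
next
  case (Suc k)
  then have "f differentiable_on S"
    and "\<And>h. C_k_on (Suc k) (\<lambda>x. frechet_derivative f (at x within S) h) S"
    unfolding C_k_on.simps(2)[of "Suc k"] by blast+
  then show ?case
    unfolding C_k_on.simps(2)[of k f] using Suc.IH by blast
qed

text \<open>At a limit point of \<open>S\<close> the derivative within \<open>S\<close> is unique,
  so the value chosen by \<open>frechet_derivative\<close> is the expected linear map.\<close>

lemma frechet_derivative_within_real:
  fixes f :: "real \<Rightarrow> 'a::real_normed_vector"
  assumes "at x within S \<noteq> bot" "(f has_vector_derivative f') (at x within S)"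
  shows "frechet_derivative f (at x within S) h = h *\<^sub>R f'"
proof -
  let ?D = "frechet_derivative f (at x within S)"
  have D: "(f has_derivative ?D) (at x within S)"
    using assms(2) differentiableI_vector frechet_derivative_works by blast
  then have lin: "?D h = h *\<^sub>R ?D 1" for h
    using linear_scale[OF has_derivative_linear[OF D], of h 1] by simp
  then have "?D = (\<lambda>h. h *\<^sub>R ?D 1)"
    by blast
  then have "(f has_vector_derivative ?D 1) (at x within S)"
    using D unfolding has_vector_derivative_def by simp
  then show ?thesis
    using lin assms vector_derivative_unique_within by metis
qed

lemma has_vector_derivative_compose_total:
  assumes "(F has_derivative F') (at (c x))" "(c has_vector_derivative c') (at x within A)"
  shows "((\<lambda>x. F (c x)) has_vector_derivative F' c') (at x within A)"
  using vector_derivative_diff_chain_within[OF assms(2) has_derivative_at_withinI[OF assms(1)]]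
  by (simp add: o_def)

context
  fixes S :: "real set"
  assumes perfect: "\<And>x. x \<in> S \<Longrightarrow> at x within S \<noteq> bot"
begin

text \<open>A bounded linear map commutes with differentiation. This precedes the characterization
  by vector derivatives because the proof of the latter applies it to multiplication by
  \<open>h\<close>.\<close>

lemma C_k_on_bounded_linear:
  fixes f :: "real \<Rightarrow> 'a::real_normed_vector"
  assumes "bounded_linear L" "C_k_on k f S"
  shows "C_k_on k (\<lambda>x. L (f x)) S"
  using assms(2)
proof (induction k arbitrary: f)
  case 0
  then show ?case
    using bounded_linear.continuous_on[OF assms(1)] by simp
next
  case (Suc k)
  let ?D = "\<lambda>x. vector_derivative f (at x within S)"
  have f: "(f has_vector_derivative ?D x) (at x within S)" if "x \<in> S" for x
    using Suc.prems that by (simp add: differentiable_on_def vector_derivative_works)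
  have Lf: "((\<lambda>x. L (f x)) has_vector_derivative L (?D x)) (at x within S)" if "x \<in> S" for x
    using bounded_linear.has_vector_derivative[OF assms(1) f[OF that]] .
  have "C_k_on k (\<lambda>x. L (frechet_derivative f (at x within S) h)) S" for h
    using Suc by simp
  moreover have "L (frechet_derivative f (at x within S) h) =
      frechet_derivative (\<lambda>x. L (f x)) (at x within S) h" if "x \<in> S" for x h
    using that perfect
    by (simp add: frechet_derivative_within_real[OF perfect f]
        frechet_derivative_within_real[OF perfect Lf] linear_simps[OF assms(1)])
  ultimately have "C_k_on k (\<lambda>x. frechet_derivative (\<lambda>x. L (f x)) (at x within S) h) S" for h
    using C_k_on_cong[of S "\<lambda>x. L (frechet_derivative f (at x within S) h)"
        "\<lambda>x. frechet_derivative (\<lambda>x. L (f x)) (at x within S) h" k] by blast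
  then show ?case
    using Lf by (auto simp: differentiable_on_def intro: differentiableI_vector)
qed

text \<open>On the line the derivative in direction \<open>h\<close> is \<open>h\<close> times the
  one in direction \<open>1\<close>, so the recursion over all directions collapses to a single
  derivative. Inductions on \<open>k\<close> then only have to exhibit \<open>f'\<close>.\<close>

lemma C_k_on_Suc_iff_vector_derivative:
  fixes f :: "real \<Rightarrow> 'a::real_normed_vector"
  shows "C_k_on (Suc k) f S \<longleftrightarrow>
    (\<exists>f'. (\<forall>x\<in>S. (f has_vector_derivative f' x) (at x within S)) \<and> C_k_on k f' S)"
proof
  assume f: "C_k_on (Suc k) f S"
  let ?D = "\<lambda>x. vector_derivative f (at x within S)"
  have D: "(f has_vector_derivative ?D x) (at x within S)" if "x \<in> S" for x
    using f that by (simp add: differentiable_on_def vector_derivative_works)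
  moreover have "C_k_on k ?D S"
  proof -
    have "C_k_on k (\<lambda>x. frechet_derivative f (at x within S) 1) S"
      using f by simp
    then show ?thesis
      using C_k_on_cong[of S "\<lambda>x. frechet_derivative f (at x within S) 1" ?D]
        frechet_derivative_within_real[OF perfect D] by simp
  qed
  ultimately show "\<exists>f'. (\<forall>x\<in>S. (f has_vector_derivative f' x) (at x within S)) \<and> C_k_on k f' S"
    by (intro exI[of _ ?D]) simp
next
  assume "\<exists>f'. (\<forall>x\<in>S. (f has_vector_derivative f' x) (at x within S)) \<and> C_k_on k f' S"
  then obtain f' where D: "\<And>x. x \<in> S \<Longrightarrow> (f has_vector_derivative f' x) (at x within S)"
    and f': "C_k_on k f' S"
    by blast
  have "C_k_on k (\<lambda>x. frechet_derivative f (at x within S) h) S" for h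
    using C_k_on_bounded_linear[OF bounded_linear_scaleR_right f', of h]
      C_k_on_cong[of S "\<lambda>x. frechet_derivative f (at x within S) h" "\<lambda>x. h *\<^sub>R f' x"]
      frechet_derivative_within_real[OF perfect D] by simp
  then show "C_k_on (Suc k) f S"
    using D by (auto simp: differentiable_on_def intro: differentiableI_vector)
qed

section \<open>Closure of C^k under sums, products and composition\<close>

lemma C_k_on_add:
  fixes f g :: "real \<Rightarrow> 'a::real_normed_vector"
  assumes "C_k_on k f S" "C_k_on k g S"
  shows "C_k_on k (\<lambda>x. f x + g x) S"
  using assms
proof (induction k arbitrary: f g)
  case 0
  then show ?case
    by (simp add: continuous_on_add)
next
  case (Suc k)
  then obtain f' g' where
    "\<forall>x\<in>S. (f has_vector_derivative f' x) (at x within S)" "C_k_on k f' S"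
    "\<forall>x\<in>S. (g has_vector_derivative g' x) (at x within S)" "C_k_on k g' S"
    unfolding C_k_on_Suc_iff_vector_derivative by blast
  then show ?case
    unfolding C_k_on_Suc_iff_vector_derivative using Suc.IH
    by (intro exI[of _ "\<lambda>x. f' x + g' x"]) (auto intro: has_vector_derivative_add)
qed

lemma C_k_on_sum:
  fixes f :: "'i \<Rightarrow> real \<Rightarrow> 'a::real_normed_vector"
  assumes "\<And>i. i \<in> A \<Longrightarrow> C_k_on k (f i) S"
  shows "C_k_on k (\<lambda>x. \<Sum>i\<in>A. f i x) S"
proof -
  \<comment> \<open>Covers the empty sum, and also sums over infinite index sets, which are
    \<open>0\<close> by convention.\<close>
  have zero: "C_k_on k (\<lambda>x. 0 :: 'a) S"
  proof (induction k)
    case (Suc k)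
    then show ?case
      unfolding C_k_on_Suc_iff_vector_derivative by (intro exI[of _ "\<lambda>_. 0"]) simp
  qed simp
  show ?thesis
    using assms by (induction A rule: infinite_finite_induct) (simp_all add: zero C_k_on_add)
qed

text \<open>Leibniz rule: each product in the derivative pairs a derivative of class C^k with a
  factor lowered from C^(k+1) to C^k, so the induction hypothesis applies to both.\<close>

lemma C_k_on_scaleR:
  fixes r :: "real \<Rightarrow> real" and f :: "real \<Rightarrow> 'a::real_normed_vector"
  assumes "C_k_on k r S" "C_k_on k f S"
  shows "C_k_on k (\<lambda>x. r x *\<^sub>R f x) S"
  using assms
proof (induction k arbitrary: r f)
  case 0
  then show ?case
    by (simp add: continuous_on_scaleR)
next
  case (Suc k)
  then obtain r' f' where
    r': "\<forall>x\<in>S. (r has_vector_derivative r' x) (at x within S)" "C_k_on k r' S" and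
    f': "\<forall>x\<in>S. (f has_vector_derivative f' x) (at x within S)" "C_k_on k f' S"
    unfolding C_k_on_Suc_iff_vector_derivative by blast
  have "C_k_on k (\<lambda>x. r x *\<^sub>R f' x + r' x *\<^sub>R f x) S"
    using C_k_on_Suc_imp[OF Suc.prems(1)] C_k_on_Suc_imp[OF Suc.prems(2)] r'(2) f'(2)
    by (intro C_k_on_add Suc.IH)
  moreover have "((\<lambda>x. r x *\<^sub>R f x) has_vector_derivative r x *\<^sub>R f' x + r' x *\<^sub>R f x) (at x within S)"
    if "x \<in> S" for x
    using r' f' that
    by (intro has_vector_derivative_scaleR)
      (auto simp: has_real_derivative_iff_has_vector_derivative)
  ultimately show ?case
    unfolding C_k_on_Suc_iff_vector_derivative
    by (intro exI[of _ "\<lambda>x. r x *\<^sub>R f' x + r' x *\<^sub>R f x"]) simp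
qed

text \<open>The derivative of the composite applies DF to the moving vector \<open>c' x\<close>,
  while \<open>C_k_on\<close> controls DF only in fixed directions. Expanding \<open>c' x\<close> in
  the basis leaves scalar coefficients times fixed-direction derivatives of \<open>F\<close> along
  \<open>c\<close>; to these the induction hypothesis, general in \<open>F\<close>, applies.\<close>

lemma C_k_on_compose:
  fixes F :: "'a::euclidean_space \<Rightarrow> 'b::real_normed_vector"
  assumes "C_k_on k F UNIV" "C_k_on k c S"
  shows "C_k_on k (\<lambda>x. F (c x)) S"
  using assms
proof (induction k arbitrary: F)
  case 0
  then show ?case
    by (auto intro: continuous_on_compose2)
next
  case (Suc k)
  then obtain c' where
    c': "\<forall>x\<in>S. (c has_vector_derivative c' x) (at x within S)" "C_k_on k c' S"
    unfolding C_k_on_Suc_iff_vector_derivative by blast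
  let ?D = "\<lambda>y. frechet_derivative F (at y)"
  have F: "(F has_derivative ?D y) (at y)" for y
    using Suc.prems(1) by (simp add: differentiable_on_def frechet_derivative_works)
  have expand: "?D (c x) (c' x) = (\<Sum>i\<in>Basis. (c' x \<bullet> i) *\<^sub>R ?D (c x) i)" for x
  proof -
    have "?D (c x) (\<Sum>i\<in>Basis. (c' x \<bullet> i) *\<^sub>R i) = (\<Sum>i\<in>Basis. (c' x \<bullet> i) *\<^sub>R ?D (c x) i)"
      using has_derivative_linear[OF F] by (simp add: linear_sum linear_scale)
    then show ?thesis
      by (simp add: euclidean_representation)
  qed
  have "C_k_on k (\<lambda>x. \<Sum>i\<in>Basis. (c' x \<bullet> i) *\<^sub>R ?D (c x) i) S"
  proof (intro C_k_on_sum C_k_on_scaleR)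
    fix i :: 'a
    show "C_k_on k (\<lambda>x. c' x \<bullet> i) S"
      using C_k_on_bounded_linear[OF bounded_linear_inner_left c'(2)] .
    show "C_k_on k (\<lambda>x. ?D (c x) i) S"
      using Suc.prems by (intro Suc.IH C_k_on_Suc_imp[OF Suc.prems(2)]) simp
  qed
  moreover have "((\<lambda>x. F (c x)) has_vector_derivative ?D (c x) (c' x)) (at x within S)"
    if "x \<in> S" for x
    using that c' by (intro has_vector_derivative_compose_total[OF F]) blast
  ultimately show ?case
    unfolding C_k_on_Suc_iff_vector_derivative expand
    by (intro exI[of _ "\<lambda>x. \<Sum>i\<in>Basis. (c' x \<bullet> i) *\<^sub>R ?D (c x) i"]) simp
qed

lemma smooth_on_compose:
  fixes F :: "'a::euclidean_space \<Rightarrow> 'b::real_normed_vector"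
  assumes "smooth_on F UNIV" "smooth_on c S"
  shows "smooth_on (\<lambda>x. F (c x)) S"
  using assms C_k_on_compose unfolding smooth_on_def by blast

end

text \<open>A connected set that is not a singleton has no isolated points. Endpoints are included,
  so one-sided derivatives are unique there too.\<close>

lemma at_within_interval_neq_bot:
  fixes S :: "real set"
  assumes "is_interval S" "interior S \<noteq> {}" "x \<in> S"
  shows "at x within S \<noteq> bot"
proof -
  have "S \<noteq> {y}" for y
    using assms(2) by auto
  then show ?thesis
    using assms connected_imp_perfect[of S x]
    by (simp add: is_interval_connected_1 trivial_limit_within)
qed

subsection \<open>Differentiating a flow with respect to its initial point\<close>

text \<open>The growth bound is only assumed in the ball of radius r; a first exit from the ball
  is excluded because the quantity |u|^2 + d^2, damped by exp (-K t), decreases until then.\<close>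

lemma gronwall_in_ball:
  fixes u :: "real \<Rightarrow> 'a::real_inner"
  assumes "0 \<le> \<tau>" "0 \<le> L" "0 \<le> d"
    and u: "\<And>t. t \<in> {0..\<tau>} \<Longrightarrow> (u has_vector_derivative u' t) (at t within {0..\<tau>})"
    and "u 0 = 0"
    and growth: "\<And>t. t \<in> {0..\<tau>} \<Longrightarrow> norm (u t) \<le> r \<Longrightarrow> norm (u' t) \<le> L * norm (u t) + d"
    and small: "d * exp ((L + 1/2) * \<tau>) < r"
  shows "norm (u \<tau>) \<le> d * exp ((L + 1/2) * \<tau>)"
proof -
  \<comment> \<open>The norm is not differentiable at 0, so its square is estimated. Differentiation
    doubles \<open>L\<close>, and the mixed term \<open>2 * norm (u t) * d\<close> is at most
    \<open>(norm (u t))\<^sup>2 + d\<^sup>2\<close>, which adds 1. Taking the root at the end halves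
    \<open>K\<close>, whence the exponent \<open>L + 1/2\<close>.\<close>
  define K where "K = 2 * L + 1"
  define q where "q t = (u t \<bullet> u t + d\<^sup>2) * exp (- K * t)" for t
  have cont_u: "continuous_on {0..\<tau>} u"
    using u has_vector_derivative_continuous continuous_on_eq_continuous_within by blast
  \<comment> \<open>Only times strictly before \<open>s\<close> must lie in the ball, so this
    applies at the first exit time itself and, once exit is excluded, at
    \<open>\<tau>\<close>.\<close>
  have bound: "norm (u s) \<le> d * exp ((L + 1/2) * \<tau>)"
    if s: "s \<in> {0..\<tau>}" and inside: "\<And>t. 0 < t \<Longrightarrow> t < s \<Longrightarrow> norm (u t) \<le> r" for s
  proof -
    have "q s \<le> q 0"
    proof (rule DERIV_nonpos_imp_decreasing_open[where f = q])
      show "0 \<le> s" using s by simp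
      show "continuous_on {0..s} q"
        unfolding q_def using s
        by (intro continuous_intros continuous_on_subset[OF cont_u]) auto
      fix t assume t: "0 < t" "t < s"
      have "(u has_vector_derivative u' t) (at t within {0<..<\<tau>})"
        using u[of t] t s by (auto intro: has_vector_derivative_within_subset)
      then have "(u has_vector_derivative u' t) (at t)"
        using t s by (simp add: at_within_open[of t "{0<..<\<tau>}"])
      then have "(u has_derivative (\<lambda>h. h *\<^sub>R u' t)) (at t)"
        by (simp add: has_vector_derivative_def)
      then have "((\<lambda>t. u t \<bullet> u t) has_derivative (*) (2 * (u t \<bullet> u' t))) (at t)"
        by (auto intro!: derivative_eq_intros simp: inner_commute algebra_simps fun_eq_iff)
      then have [derivative_intros]:
        "((\<lambda>t. u t \<bullet> u t) has_real_derivative 2 * (u t \<bullet> u' t)) (at t)"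
        by (simp add: has_field_derivative_def)
      have "(q has_real_derivative
          (2 * (u t \<bullet> u' t) - K * (u t \<bullet> u t + d\<^sup>2)) * exp (- K * t)) (at t)"
        unfolding q_def[abs_def]
        by (auto intro!: derivative_eq_intros simp: algebra_simps)
      moreover have "2 * (u t \<bullet> u' t) \<le> K * (u t \<bullet> u t + d\<^sup>2)"
      proof -
        have "u t \<bullet> u' t \<le> norm (u t) * norm (u' t)"
          by (rule norm_cauchy_schwarz)
        also have "\<dots> \<le> norm (u t) * (L * norm (u t) + d)"
          using growth[of t] inside[of t] t s by (intro mult_left_mono) auto
        finally have "2 * (u t \<bullet> u' t) \<le> 2 * L * (norm (u t))\<^sup>2 + 2 * norm (u t) * d"
          by (simp add: power2_eq_square algebra_simps)
        also have "\<dots> \<le> 2 * L * (norm (u t))\<^sup>2 + ((norm (u t))\<^sup>2 + d\<^sup>2)"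
          using sum_squares_bound[of "norm (u t)" d] by simp
        also have "\<dots> \<le> K * ((norm (u t))\<^sup>2 + d\<^sup>2)"
          using assms(2) by (simp add: K_def algebra_simps)
        finally show ?thesis
          by (simp add: dot_square_norm)
      qed
      ultimately show "\<exists>y. (q has_real_derivative y) (at t) \<and> y \<le> 0"
        by (meson diff_le_0_iff_le exp_ge_zero mult_nonpos_nonneg)
    qed
    then have "((norm (u s))\<^sup>2 + d\<^sup>2) * exp (- K * s) \<le> d\<^sup>2"
      by (simp add: q_def \<open>u 0 = 0\<close> dot_square_norm)
    then have "((norm (u s))\<^sup>2 + d\<^sup>2) \<le> d\<^sup>2 * exp (K * s)"
      by (simp add: exp_minus field_simps)
    also have "\<dots> \<le> d\<^sup>2 * exp (K * \<tau>)"
      using s assms(2) by (intro mult_left_mono) (auto simp: K_def mult_left_mono)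
    also have "\<dots> = (d * exp ((L + 1/2) * \<tau>))\<^sup>2"
      by (simp add: power_mult_distrib K_def flip: exp_double)
    finally have "(norm (u s))\<^sup>2 \<le> (d * exp ((L + 1/2) * \<tau>))\<^sup>2"
      using zero_le_power2[of d] by linarith
    then show ?thesis
      by (rule power2_le_imp_le) (simp add: assms(3))
  qed
  have "norm (u t) \<le> r" if "t \<in> {0..\<tau>}" for t
  proof (rule ccontr)
    assume "\<not> norm (u t) \<le> r"
    \<comment> \<open>Using \<open>{r..}\<close> rather than norms above \<open>r\<close> makes
      \<open>E\<close> closed, so a first time in \<open>E\<close> exists; there the bound gives a
      norm below \<open>r\<close>.\<close>
    define E where "E = {0..\<tau>} \<inter> (\<lambda>t. norm (u t)) -` {r..}"
    have "closed E"
      unfolding E_def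
      by (intro continuous_closed_preimage continuous_on_norm cont_u) auto
    then have "compact E"
      by (metis E_def bounded_Int bounded_closed_interval compact_eq_bounded_closed)
    moreover have "t \<in> E"
      using \<open>\<not> norm (u t) \<le> r\<close> that by (simp add: E_def)
    ultimately obtain s where s: "s \<in> E" and first: "\<And>t. t \<in> E \<Longrightarrow> s \<le> t"
      using compact_attains_inf[of E] by blast
    have "norm (u t) \<le> r" if "0 < t" "t < s" for t
      using first[of t] that s by (force simp: E_def)
    then have "norm (u s) \<le> d * exp ((L + 1/2) * \<tau>)"
      using s by (intro bound) (auto simp: E_def)
    then show False
      using s small by (simp add: E_def)
  qed
  then show ?thesis
    using assms(1) by (intro bound) auto
qed

text \<open>\<open>A\<close> is uniformly continuous on a compact tube containing the curve, which
  makes \<open>\<rho>\<close> independent of \<open>t\<close>. The mean value inequality on a ball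
  around \<open>x t\<close> then turns the oscillation of \<open>A\<close> into the linearization
  error.\<close>

lemma uniform_linearization_along_curve:
  fixes v :: "'a::euclidean_space \<Rightarrow> real \<Rightarrow> 'b::real_normed_vector"
    and A :: "'a \<times> real \<Rightarrow> 'a \<Rightarrow>\<^sub>L 'b"
  assumes v: "\<And>x t. t \<in> {0..\<tau>} \<Longrightarrow> ((\<lambda>x. v x t) has_derivative blinfun_apply (A (x, t))) (at x)"
    and A: "continuous_on (UNIV \<times> {0..\<tau>}) A"
    and x: "\<And>t. t \<in> {0..\<tau>} \<Longrightarrow> norm (x t) \<le> R"
    and "0 < \<eta>"
  obtains \<rho> where "0 < \<rho>"
    "\<And>t k. t \<in> {0..\<tau>} \<Longrightarrow> norm k \<le> \<rho> \<Longrightarrow>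
       norm (v (x t + k) t - v (x t) t - A (x t, t) k) \<le> \<eta> * norm k"
proof -
  let ?C = "cball 0 (R + 1) \<times> {0..\<tau>}"
  have "uniformly_continuous_on ?C A"
    by (intro compact_uniformly_continuous compact_Times compact_cball compact_Icc
        continuous_on_subset[OF A]) auto
  then obtain d where "0 < d" and
    d: "\<And>y z. y \<in> ?C \<Longrightarrow> z \<in> ?C \<Longrightarrow> dist z y < d \<Longrightarrow> dist (A z) (A y) < \<eta>"
    unfolding uniformly_continuous_on_def using \<open>0 < \<eta>\<close> by metis
  \<comment> \<open>The 1 keeps the ball around \<open>x t\<close> inside radius
    \<open>R + 1\<close>; halving \<open>d\<close> yields the strict inequality from the closed
    ball.\<close>
  define \<rho> where "\<rho> = min 1 (d / 2)"
  show ?thesis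
  proof
    show "0 < \<rho>"
      using \<open>0 < d\<close> by (simp add: \<rho>_def)
    fix t and k :: 'a assume t: "t \<in> {0..\<tau>}" and k: "norm k \<le> \<rho>"
    have "norm (v (x t + k) t - v (x t) t - A (x t, t) (x t + k - x t)) \<le> norm (x t + k - x t) * \<eta>"
    proof (rule differentiable_bound_linearization[where S = "cball (x t) \<rho>"
          and f' = "\<lambda>y. blinfun_apply (A (y, t))" and f = "\<lambda>y. v y t"])
      show "x t + \<theta> *\<^sub>R (x t + k - x t) \<in> cball (x t) \<rho>" if "\<theta> \<in> {0..1}" for \<theta>
        using that k mult_left_le_one_le[of "norm k" \<theta>] by (auto simp: dist_norm)
      show "((\<lambda>y. v y t) has_derivative blinfun_apply (A (y, t))) (at y within cball (x t) \<rho>)" for y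
        using v[OF t] has_derivative_at_withinI by blast
      show "x t \<in> cball (x t) \<rho>"
        using \<open>0 < \<rho>\<close> by simp
      fix y assume y: "y \<in> cball (x t) \<rho>"
      have "norm y \<le> norm (x t) + norm (y - x t)"
        using norm_triangle_ineq[of "x t" "y - x t"] by simp
      then have "norm y \<le> R + 1"
        using y x[OF t] by (simp add: dist_norm norm_minus_commute \<rho>_def)
      then have "dist (A (y, t)) (A (x t, t)) < \<eta>"
        using y t x[OF t] \<open>0 < d\<close> by (intro d) (auto simp: dist_Pair_Pair dist_commute \<rho>_def)
      then show "onorm (blinfun_apply (A (y, t)) - blinfun_apply (A (x t, t))) \<le> \<eta>"
        by (simp add: dist_norm norm_blinfun.rep_eq minus_blinfun.rep_eq fun_diff_def)
    qed
    then show "norm (v (x t + k) t - v (x t) t - A (x t, t) k) \<le> \<eta> * norm k"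
      by (simp add: mult.commute)
  qed
qed

text \<open>No regularity of \<open>X\<close> in its initial point is assumed. That nearby paths
  stay close up to \<open>\<tau>\<close> comes out of the Gronwall estimate itself, since its growth
  bound is required only in a small ball.\<close>

lemma flow_has_vector_derivative_initial_point:
  fixes v X :: "'a::euclidean_space \<Rightarrow> real \<Rightarrow> 'a" and A :: "'a \<times> real \<Rightarrow> 'a \<Rightarrow>\<^sub>L 'a"
  assumes "0 \<le> \<tau>"
    and v: "\<And>x t. t \<in> {0..\<tau>} \<Longrightarrow> ((\<lambda>x. v x t) has_derivative blinfun_apply (A (x, t))) (at x)"
    and A: "continuous_on (UNIV \<times> {0..\<tau>}) A"
    and X: "\<And>c t. t \<in> {0..\<tau>} \<Longrightarrow> (X c has_vector_derivative v (X c t) t) (at t within {0..\<tau>})"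
    and X0: "\<And>c. X c 0 = c"
    and w: "\<And>t. t \<in> {0..\<tau>} \<Longrightarrow> (w has_vector_derivative A (X a t, t) (w t)) (at t within {0..\<tau>})"
    and w0: "w 0 = h"
  shows "((\<lambda>\<epsilon>. X (a + \<epsilon> *\<^sub>R h) \<tau>) has_vector_derivative w \<tau>) (at 0)"
proof -
  have cont_X: "continuous_on {0..\<tau>} (X a)" and cont_w: "continuous_on {0..\<tau>} w"
    using X w has_vector_derivative_continuous continuous_on_eq_continuous_within by blast+
  have cont_A: "continuous_on {0..\<tau>} (\<lambda>t. A (X a t, t))"
    using cont_X by (intro continuous_on_compose2[OF A] continuous_intros) auto
  have bdd: "\<exists>M>0. \<forall>t\<in>{0..\<tau>}. norm (f t) \<le> M" if "continuous_on {0..\<tau>} f"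
    for f :: "real \<Rightarrow> 'c::real_normed_vector"
  proof -
    have "bounded (f ` {0..\<tau>})"
      using that by (intro compact_imp_bounded compact_continuous_image) auto
    then show ?thesis
      unfolding bounded_pos by blast
  qed
  obtain R where R: "\<And>t. t \<in> {0..\<tau>} \<Longrightarrow> norm (X a t) \<le> R"
    using bdd[OF cont_X] by blast
  obtain W where "0 < W" and W: "\<And>t. t \<in> {0..\<tau>} \<Longrightarrow> norm (w t) \<le> W"
    using bdd[OF cont_w] by blast
  obtain M where "0 < M" and M: "\<And>t. t \<in> {0..\<tau>} \<Longrightarrow> norm (A (X a t, t)) \<le> M"
    using bdd[OF cont_A] by blast
  \<comment> \<open>\<open>M\<close> bounds the linear part and 1 bounds \<open>\<eta>\<close>, so
    \<open>L\<close>, and with it the growth factor \<open>c\<close>, does not depend on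
    \<open>e\<close>.\<close>
  define L where "L = M + 1"
  define c where "c = exp ((L + 1/2) * \<tau>)"
  have "1 \<le> c"
    using \<open>0 < M\<close> \<open>0 \<le> \<tau>\<close> by (simp add: c_def L_def)
  have "\<exists>d>0. \<forall>\<epsilon>. \<bar>\<epsilon>\<bar> < d \<longrightarrow>
      norm (X (a + \<epsilon> *\<^sub>R h) \<tau> - X a \<tau> - \<epsilon> *\<^sub>R w \<tau>) \<le> e * \<bar>\<epsilon>\<bar>" if "0 < e" for e
  proof -
    \<comment> \<open>The Gronwall bound will be
      \<open>\<eta> * W * c * \<bar>\<epsilon>\<bar>\<close>, which this makes at most
      \<open>e * \<bar>\<epsilon>\<bar>\<close>.\<close>
    define \<eta> where "\<eta> = min 1 (e / (W * c))"
    have \<eta>: "0 < \<eta>" "\<eta> \<le> 1" "\<eta> * W * c \<le> e"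
      using \<open>0 < e\<close> \<open>0 < W\<close> \<open>1 \<le> c\<close> by (auto simp: \<eta>_def min_def field_simps)
    obtain \<rho> where "0 < \<rho>" and \<rho>: "\<And>t k. t \<in> {0..\<tau>} \<Longrightarrow> norm k \<le> \<rho> \<Longrightarrow>
       norm (v (X a t + k) t - v (X a t) t - A (X a t, t) k) \<le> \<eta> * norm k"
      using uniform_linearization_along_curve[where x = "X a", OF v A R \<open>0 < \<eta>\<close>] by blast
    \<comment> \<open>Makes \<open>\<bar>\<epsilon>\<bar> * W * c\<close> less than
      \<open>\<rho> / 2\<close>. As \<open>\<eta> \<le> 1\<close> and \<open>1 \<le> c\<close>, both
      the Gronwall bound and the norm of \<open>\<epsilon> *\<^sub>R w t\<close> stay below
      \<open>\<rho> / 2\<close>, so an error \<open>u t\<close> of norm at most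
      \<open>\<rho> / 2\<close> keeps the displacement within \<open>\<rho>\<close>.\<close>
    define d where "d = \<rho> / (2 * W * c)"
    have "0 < d"
      using \<open>0 < \<rho>\<close> \<open>0 < W\<close> \<open>1 \<le> c\<close> by (simp add: d_def)
    moreover have "norm (X (a + \<epsilon> *\<^sub>R h) \<tau> - X a \<tau> - \<epsilon> *\<^sub>R w \<tau>) \<le> e * \<bar>\<epsilon>\<bar>" if "\<bar>\<epsilon>\<bar> < d" for \<epsilon>
    proof -
      have Wc: "\<bar>\<epsilon>\<bar> * W * c < \<rho> / 2"
        using that \<open>0 < W\<close> \<open>1 \<le> c\<close> by (simp add: d_def field_simps)
      have Wr: "\<bar>\<epsilon>\<bar> * W \<le> \<bar>\<epsilon>\<bar> * W * c"
        using \<open>0 < W\<close> \<open>1 \<le> c\<close> mult_left_mono[of 1 c "\<bar>\<epsilon>\<bar> * W"] by simp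
      define u where "u t = X (a + \<epsilon> *\<^sub>R h) t - X a t - \<epsilon> *\<^sub>R w t" for t
      define u' where
        "u' t = v (X (a + \<epsilon> *\<^sub>R h) t) t - v (X a t) t - \<epsilon> *\<^sub>R A (X a t, t) (w t)" for t
      have "norm (u \<tau>) \<le> (\<eta> * (\<bar>\<epsilon>\<bar> * W)) * exp ((L + 1/2) * \<tau>)"
      proof (rule gronwall_in_ball[where u' = u' and r = "\<rho> / 2"])
        show "0 \<le> \<tau>" "0 \<le> L" "0 \<le> \<eta> * (\<bar>\<epsilon>\<bar> * W)"
          using assms(1) \<open>0 < M\<close> \<open>0 < W\<close> \<eta> by (auto simp: L_def)
        show "u 0 = 0"
          by (simp add: u_def X0 w0)
        show "(u has_vector_derivative u' t) (at t within {0..\<tau>})" if "t \<in> {0..\<tau>}" for t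
          unfolding u_def[abs_def] u'_def using X[OF that] w[OF that]
          by (intro has_vector_derivative_diff
              bounded_linear.has_vector_derivative[OF bounded_linear_scaleR_right])
        have "\<eta> * (\<bar>\<epsilon>\<bar> * W * c) \<le> 1 * (\<bar>\<epsilon>\<bar> * W * c)"
          using \<eta> \<open>0 < W\<close> \<open>1 \<le> c\<close> by (intro mult_right_mono) auto
        then show "\<eta> * (\<bar>\<epsilon>\<bar> * W) * exp ((L + 1/2) * \<tau>) < \<rho> / 2"
          using Wc by (simp add: c_def mult.assoc)
        fix t assume t: "t \<in> {0..\<tau>}" and ut: "norm (u t) \<le> \<rho> / 2"
        \<comment> \<open>\<open>k\<close> is the true displacement between the two paths. Linearity
          of \<open>A\<close> splits \<open>u' t\<close> into the linearization error at
          \<open>k\<close> and \<open>A\<close> applied to \<open>u t\<close>.\<close>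
        define k where "k = u t + \<epsilon> *\<^sub>R w t"
        have "norm (\<epsilon> *\<^sub>R w t) \<le> \<bar>\<epsilon>\<bar> * W"
          using W[OF t] by (simp add: mult_left_mono)
        then have k_le: "norm k \<le> norm (u t) + \<bar>\<epsilon>\<bar> * W"
          unfolding k_def using norm_triangle_ineq[of "u t" "\<epsilon> *\<^sub>R w t"] by linarith
        then have "norm k \<le> \<rho>"
          using ut Wc Wr by linarith
        have "X a t + k = X (a + \<epsilon> *\<^sub>R h) t"
          by (simp add: k_def u_def)
        then have "u' t = (v (X a t + k) t - v (X a t) t - A (X a t, t) k) + A (X a t, t) (u t)"
          by (simp add: u'_def k_def blinfun.add_right blinfun.scaleR_right)
        then have "norm (u' t) \<le>
            norm (v (X a t + k) t - v (X a t) t - A (X a t, t) k) + norm (A (X a t, t) (u t))"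
          using norm_triangle_ineq by metis
        also have "\<dots> \<le> \<eta> * (norm (u t) + \<bar>\<epsilon>\<bar> * W) + M * norm (u t)"
        proof (rule add_mono)
          show "norm (v (X a t + k) t - v (X a t) t - A (X a t, t) k) \<le> \<eta> * (norm (u t) + \<bar>\<epsilon>\<bar> * W)"
            using \<rho>[OF t \<open>norm k \<le> \<rho>\<close>] mult_left_mono[OF k_le, of \<eta>] \<eta> by linarith
          show "norm (A (X a t, t) (u t)) \<le> M * norm (u t)"
            using norm_blinfun[of "A (X a t, t)" "u t"]
              mult_right_mono[OF M[OF t] norm_ge_zero[of "u t"]] by linarith
        qed
        also have "\<dots> \<le> L * norm (u t) + \<eta> * (\<bar>\<epsilon>\<bar> * W)"
          using mult_right_mono[OF \<eta>(2) norm_ge_zero[of "u t"]] by (simp add: L_def algebra_simps)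
        finally show "norm (u' t) \<le> L * norm (u t) + \<eta> * (\<bar>\<epsilon>\<bar> * W)" .
      qed
      also have "\<dots> = (\<eta> * W * c) * \<bar>\<epsilon>\<bar>"
        by (simp add: c_def)
      also have "\<dots> \<le> e * \<bar>\<epsilon>\<bar>"
        using \<eta> by (intro mult_right_mono) auto
      finally show ?thesis
        by (simp add: u_def)
    qed
    ultimately show ?thesis
      by blast
  qed
  then show ?thesis
    unfolding has_vector_derivative_def has_derivative_at_alt
    by (simp add: bounded_linear_scaleR_left)
qed

subsection \<open>The frozen-in magnetic field\<close>

lemma smooth_on_imp_C1:
  assumes "smooth_on f S"
  obtains D where "\<And>z. z \<in> S \<Longrightarrow> (f has_derivative D z) (at z within S)"
    "\<And>h. continuous_on S (\<lambda>z. D z h)"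
proof
  have C1: "C_k_on (Suc 0) f S"
    using assms unfolding smooth_on_def by blast
  show "(f has_derivative frechet_derivative f (at z within S)) (at z within S)" if "z \<in> S" for z
    using C1 that by (simp add: differentiable_on_def frechet_derivative_works)
  show "continuous_on S (\<lambda>z. frechet_derivative f (at z within S) h)" for h
    using C1 by simp
qed

lemma smooth_on_UNIV_has_derivative:
  assumes "smooth_on f UNIV"
  shows "(f has_derivative frechet_derivative f (at x)) (at x)"
proof -
  have "C_k_on (Suc 0) f UNIV"
    using assms unfolding smooth_on_def by blast
  then show ?thesis
    by (simp add: differentiable_on_def frechet_derivative_works)
qed

text \<open>The slice at time \<open>t\<close> lies in \<open>UNIV \<times> J\<close> and is a full
  copy of space, so the spatial derivative is two-sided even when \<open>t\<close> is an endpoint of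
  \<open>J\<close>.\<close>

lemma has_derivative_space_slice:
  assumes "((\<lambda>(x, t). u x t) has_derivative D) (at (x, t) within UNIV \<times> J)" "t \<in> J"
  shows "((\<lambda>x. u x t) has_derivative (\<lambda>k. D (k, 0))) (at x)"
proof -
  have "((\<lambda>x. (x, t)) has_derivative (\<lambda>k. (k, 0))) (at x)"
    by (auto intro!: derivative_eq_intros)
  moreover have "((\<lambda>(x, t). u x t) has_derivative D) (at (x, t) within range (\<lambda>x. (x, t)))"
    using assms by (auto intro: has_derivative_subset)
  ultimately show ?thesis
    using has_derivative_in_compose[of "\<lambda>x. (x, t)" "\<lambda>k. (k, 0)" x UNIV "\<lambda>(x, t). u x t" D] by simp
qed

text \<open>Chain rule for the space-time curve \<open>(c t, t)\<close>. A constant \<open>c\<close>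
  gives the partial time derivative, a particle path the material derivative.\<close>

lemma has_vector_derivative_along_curve:
  assumes "((\<lambda>(x, t). u x t) has_derivative D) (at (c t, t) within UNIV \<times> J)"
    and "(c has_vector_derivative c') (at t within J)"
  shows "((\<lambda>t. u (c t) t) has_vector_derivative D (c', 1)) (at t within J)"
proof -
  have "((\<lambda>t. (c t, t)) has_vector_derivative (c', 1)) (at t within J)"
    using assms(2) by (auto intro!: has_vector_derivative_Pair)
  moreover have "((\<lambda>(x, t). u x t) has_derivative D) (at (c t, t) within (\<lambda>t. (c t, t)) ` J)"
    using assms(1) by (auto intro: has_derivative_subset)
  ultimately show ?thesis
    using vector_derivative_diff_chain_within[of "\<lambda>t. (c t, t)" "(c', 1)" t J "\<lambda>(x, t). u x t" D]
    by (simp add: o_def)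
qed

text \<open>Each partial derivative is \<open>u'\<close> at a basis vector, so by linearity the sum
  is the derivative of \<open>u\<close> in direction \<open>w x\<close>.\<close>

lemma advect_eq_derivative:
  assumes "(u has_derivative u') (at x)"
  shows "advect w u x = u' (w x)"
proof -
  have "partial_deriv j u x = u' (axis j 1)" for j
  proof -
    have "((\<lambda>h. x + h *\<^sub>R axis j 1) has_vector_derivative axis j 1) (at 0)"
      by (auto intro!: derivative_eq_intros)
    then have "((\<lambda>h. u (x + h *\<^sub>R axis j 1)) has_vector_derivative u' (axis j 1)) (at 0)"
      using assms has_vector_derivative_compose_total[where c = "\<lambda>h. x + h *\<^sub>R axis j 1" and x = 0]
      by simp
    then show ?thesis
      unfolding partial_deriv_def by (rule vector_derivative_at)
  qed
  then have "advect w u x = u' (\<Sum>j\<in>UNIV. (w x $ j) *\<^sub>R axis j 1)"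
    using has_derivative_linear[OF assms] by (simp add: advect_def linear_sum linear_scale)
  then show ?thesis
    using basis_expansion[of "w x"] by (simp add: scalar_mult_eq_scaleR)
qed

section \<open>The time interval and the Cauchy formula for the magnetic field\<close>

lemma time_dom_downward:
  assumes "t \<in> time_dom T" "0 \<le> s" "s \<le> t"
  shows "s \<in> time_dom T"
  using assms le_less_trans[of "ereal s" "ereal t" T] by (simp add: time_dom_def)

text \<open>Makes derivatives within the time interval unique, so that \<open>time_deriv\<close>,
  defined by choice, equals any derivative computed by the chain rule.\<close>

lemma time_dom_neq_bot:
  assumes "0 < T" "t \<in> time_dom T"
  shows "at t within time_dom T \<noteq> bot"
proof (rule at_within_interval_neq_bot)
  show "is_interval (time_dom T)"
    unfolding is_interval_1 using time_dom_downward by (auto simp: time_dom_def)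
  obtain r where "0 < r" "ereal r < T"
    using ereal_dense2[OF assms(1)] by (auto simp: zero_ereal_def)
  then have "r \<in> time_dom T"
    by (simp add: time_dom_def)
  then have "{0<..<r} \<subseteq> time_dom T"
    using time_dom_downward by auto
  then have "{0<..<r} \<subseteq> interior (time_dom T)"
    by (simp add: interior_maximal)
  then show "interior (time_dom T) \<noteq> {}"
    using \<open>0 < r\<close> by (metis dense greaterThanLessThan_iff subset_empty empty_iff)
qed (fact assms(2))

text \<open>Cauchy formula: the derivative of the flow map carries the initial field to the current
  one. Both sides are the derivative of \<open>X (a + \<epsilon> *\<^sub>R b a 0) \<tau>\<close> at
  \<open>\<epsilon> = 0\<close>, one by the chain rule, the other by the linearized flow
  equation.\<close>

lemma frozen_in_field:
  assumes "0 < T" and mhd: "smooth_ideal_mhd_solution T v b p"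
    and traj: "particle_trajectory_map T v X" and \<tau>: "\<tau> \<in> time_dom T"
    and F': "((\<lambda>a. X a \<tau>) has_derivative F') (at a)"
  shows "F' (b a 0) = b (X a \<tau>) \<tau>"
proof -
  let ?J = "time_dom T"
  obtain Dv where
    Dv: "\<And>z. z \<in> UNIV \<times> ?J \<Longrightarrow> ((\<lambda>(x, t). v x t) has_derivative Dv z) (at z within UNIV \<times> ?J)" and
    cont_Dv: "\<And>h. continuous_on (UNIV \<times> ?J) (\<lambda>z. Dv z h)"
    using mhd smooth_on_imp_C1 unfolding smooth_ideal_mhd_solution_def by metis
  obtain Db where
    Db: "\<And>z. z \<in> UNIV \<times> ?J \<Longrightarrow> ((\<lambda>(x, t). b x t) has_derivative Db z) (at z within UNIV \<times> ?J)"
    using mhd smooth_on_imp_C1 unfolding smooth_ideal_mhd_solution_def by metis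
  have sub: "{0..\<tau>} \<subseteq> ?J"
    using time_dom_downward[OF \<tau>] by auto
  \<comment> \<open>The spatial part of the derivative of \<open>v\<close> as a bounded operator;
    \<open>Blinfun\<close> is meaningful only for a bounded linear argument, which is known for
    times in \<open>?J\<close>.\<close>
  define A where "A z = Blinfun (\<lambda>k. Dv z (k, 0))" for z
  have v_slice: "((\<lambda>x. v x t) has_derivative (\<lambda>k. Dv (x, t) (k, 0))) (at x)" if "t \<in> ?J" for x t
    using that by (intro has_derivative_space_slice[OF Dv]) auto
  have A_apply: "blinfun_apply (A (x, t)) = (\<lambda>k. Dv (x, t) (k, 0))" if "t \<in> ?J" for x t
    unfolding A_def
    by (rule bounded_linear_Blinfun_apply) (rule has_derivative_bounded_linear[OF v_slice[OF that]])
  have "continuous_on (UNIV \<times> ?J) A"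
  \<comment> \<open>Continuity is known for each fixed direction; in finite dimension this gives
    continuity in operator norm.\<close>
  proof (rule continuous_on_blinfun_componentwise)
    fix i :: "real^3"
    have "continuous_on (UNIV \<times> ?J) (\<lambda>z. A z i) \<longleftrightarrow> continuous_on (UNIV \<times> ?J) (\<lambda>z. Dv z (i, 0))"
      by (rule continuous_on_cong) (auto simp: A_apply)
    then show "continuous_on (UNIV \<times> ?J) (\<lambda>z. A z i)"
      using cont_Dv by blast
  qed
  then have A: "continuous_on (UNIV \<times> {0..\<tau>}) A"
    using sub by (auto intro: continuous_on_subset)
  have X0: "X c 0 = c" for c
    using traj by (simp add: particle_trajectory_map_def)
  have X: "(X c has_vector_derivative v (X c t) t) (at t within ?J)" if "t \<in> ?J" for c t
    using traj that by (simp add: particle_trajectory_map_def)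
  \<comment> \<open>The induction equation read along a particle path: the material derivative of
    \<open>b\<close> is the spatial derivative of \<open>v\<close> applied to
    \<open>b\<close>.\<close>
  have w: "((\<lambda>t. b (X a t) t) has_vector_derivative A (X a t, t) (b (X a t) t)) (at t within ?J)"
    if t: "t \<in> ?J" for t
  proof -
    let ?x = "X a t" and ?D = "Db (X a t, t)"
    have D: "((\<lambda>(x, t). b x t) has_derivative ?D) (at (?x, t) within UNIV \<times> ?J)"
      using t by (intro Db) simp
    have "((\<lambda>s. b ?x s) has_vector_derivative ?D (0, 1)) (at t within ?J)"
      using has_vector_derivative_along_curve[where c = "\<lambda>_. ?x", OF D] by simp
    then have "time_deriv T b ?x t = ?D (0, 1)"
      unfolding time_deriv_def using time_dom_neq_bot[OF assms(1) t] vector_derivative_within by blast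
    moreover have "advect (\<lambda>y. v y t) (\<lambda>y. b y t) ?x = ?D (v ?x t, 0)"
      using advect_eq_derivative[OF has_derivative_space_slice[OF D t]] .
    moreover have "advect (\<lambda>y. b y t) (\<lambda>y. v y t) ?x = A (?x, t) (b ?x t)"
      using advect_eq_derivative[OF v_slice[OF t]] by (simp add: A_apply[OF t])
    moreover have "time_deriv T b ?x t + advect (\<lambda>y. v y t) (\<lambda>y. b y t) ?x
        = advect (\<lambda>y. b y t) (\<lambda>y. v y t) ?x"
      using mhd t unfolding smooth_ideal_mhd_solution_def by blast
    moreover have "?D (v ?x t, 1) = ?D (0, 1) + ?D (v ?x t, 0)"
      using linear_add[OF has_derivative_linear[OF D], of "(0, 1)" "(v ?x t, 0)"] by simp
    ultimately show ?thesis
      using has_vector_derivative_along_curve[OF D X[OF t]] by simp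
  qed
  have "((\<lambda>\<epsilon>. X (a + \<epsilon> *\<^sub>R b a 0) \<tau>) has_vector_derivative b (X a \<tau>) \<tau>) (at 0)"
  proof (rule flow_has_vector_derivative_initial_point[where A = A and w = "\<lambda>t. b (X a t) t"])
    show "continuous_on (UNIV \<times> {0..\<tau>}) A"
      by (fact A)
    show "0 \<le> \<tau>"
      using \<tau> by (simp add: time_dom_def)
    show "((\<lambda>x. v x t) has_derivative blinfun_apply (A (x, t))) (at x)" if "t \<in> {0..\<tau>}" for x t
      using v_slice[of t x] A_apply[of t x] that sub by auto
    show "(X c has_vector_derivative v (X c t) t) (at t within {0..\<tau>})" if "t \<in> {0..\<tau>}" for c t
      using X that sub has_vector_derivative_within_subset by blast
    show "((\<lambda>t. b (X a t) t) has_vector_derivative A (X a t, t) (b (X a t) t)) (at t within {0..\<tau>})"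
      if "t \<in> {0..\<tau>}" for t
      using w that sub has_vector_derivative_within_subset by blast
  qed (simp_all add: X0)
  moreover have "((\<lambda>\<epsilon>. X (a + \<epsilon> *\<^sub>R b a 0) \<tau>) has_vector_derivative F' (b a 0)) (at 0)"
  proof -
    have "((\<lambda>\<epsilon>. a + \<epsilon> *\<^sub>R b a 0) has_vector_derivative b a 0) (at 0)"
      by (auto intro!: derivative_eq_intros)
    then show ?thesis
      using F' has_vector_derivative_compose_total[where c = "\<lambda>\<epsilon>. a + \<epsilon> *\<^sub>R b a 0" and x = 0
          and F = "\<lambda>a. X a \<tau>"]
      by simp
  qed
  ultimately show ?thesis
    using vector_derivative_unique_at by blast
qed

section \<open>Transport of the integral curve\<close>

text \<open>Differentiating \<open>inv F (F x) = x\<close> gives \<open>F'\<close> a left inverse.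
  This keeps the tangent of the transported curve nonzero.\<close>

lemma diffeomorphism_derivative_inj:
  assumes "diffeomorphism F" "(F has_derivative F') (at x)" "F' h = 0"
  shows "h = 0"
proof -
  define G' where "G' y = frechet_derivative (inv F) (at y)" for y
  have G': "(inv F has_derivative G' y) (at y)" for y
    using assms(1) smooth_on_UNIV_has_derivative unfolding diffeomorphism_def G'_def by blast
  then have "((\<lambda>x. inv F (F x)) has_derivative (\<lambda>k. G' (F x) (F' k))) (at x)"
    using has_derivative_compose[OF assms(2)] by blast
  moreover have "(\<lambda>x. inv F (F x)) = (\<lambda>x. x)"
    using assms(1) by (auto simp: diffeomorphism_def bij_is_inj)
  ultimately have "(\<lambda>k. G' (F x) (F' k)) = (\<lambda>k. k)"
    using has_derivative_unique has_derivative_ident by metis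
  then have "h = G' (F x) (F' h)"
    by metis
  also have "\<dots> = 0"
    using linear_0[OF has_derivative_linear[OF G']] assms(3) by simp
  finally show ?thesis .
qed

theorem theorem2p6:
  fixes T :: ereal
    and v b X :: "real^3 \<Rightarrow> real \<Rightarrow> real^3"
    and p :: "real^3 \<Rightarrow> real \<Rightarrow> real"
    and v0 b0 :: "real^3 \<Rightarrow> real^3"
    and I :: "real set"
    and \<gamma>0 :: "real \<Rightarrow> real^3"
    and \<gamma> :: "real \<Rightarrow> real \<Rightarrow> real^3"
  assumes "0 < T"
    and "smooth_ideal_mhd_solution T v b p"
    and "\<And>x. divergence v0 x = 0" and "\<And>x. divergence b0 x = 0"
    and "\<And>x. v x 0 = v0 x" and "\<And>x. b x 0 = b0 x"
    and "particle_trajectory_map T v X"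
    and "integral_curve b0 I \<gamma>0"
    and "\<And>s t. \<gamma> s t = X (\<gamma>0 s) t"
  shows "\<forall>t\<in>time_dom T.
           integral_curve (\<lambda>x. b x t) I (\<lambda>s. \<gamma> s t) \<and>
           (\<forall>s\<in>I. norm (b (\<gamma> s t) t) / norm (vector_derivative (\<lambda>\<sigma>. \<gamma> \<sigma> t) (at s within I))
                  = norm (b0 (\<gamma>0 s)) / norm (vector_derivative \<gamma>0 (at s within I)))"
proof
  fix t assume t: "t \<in> time_dom T"
  have I: "is_interval I" "interior I \<noteq> {}" "smooth_on \<gamma>0 I"
    and nz: "\<And>s. s \<in> I \<Longrightarrow> vector_derivative \<gamma>0 (at s within I) \<noteq> 0"
    using assms(8) by (auto simp: integral_curve_def)
  obtain f where f: "\<And>s. s \<in> I \<Longrightarrow> f s \<noteq> 0"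
    "\<And>s. s \<in> I \<Longrightarrow> vector_derivative \<gamma>0 (at s within I) = f s *\<^sub>R b0 (\<gamma>0 s)"
    using assms(8) unfolding integral_curve_def by blast
  note perfect = at_within_interval_neq_bot[OF I(1,2)]
  have diffeo: "diffeomorphism (\<lambda>a. X a t)"
    using assms(7) t by (simp add: particle_trajectory_map_def)
  define F' where "F' a = frechet_derivative (\<lambda>a. X a t) (at a)" for a
  have F': "((\<lambda>a. X a t) has_derivative F' a) (at a)" for a
    using diffeo smooth_on_UNIV_has_derivative unfolding diffeomorphism_def F'_def by blast
  have "C_k_on (Suc 0) \<gamma>0 I"
    using I(3) unfolding smooth_on_def by blast
  then have \<gamma>0: "(\<gamma>0 has_vector_derivative vector_derivative \<gamma>0 (at s within I)) (at s within I)"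
    if "s \<in> I" for s
    using that by (simp add: differentiable_on_def vector_derivative_works)
  have d\<gamma>: "vector_derivative (\<lambda>\<sigma>. \<gamma> \<sigma> t) (at s within I)
      = F' (\<gamma>0 s) (vector_derivative \<gamma>0 (at s within I))" if "s \<in> I" for s
    unfolding assms(9)
    using has_vector_derivative_compose_total[OF F' \<gamma>0[OF that]] perfect[OF that]
    by (intro vector_derivative_within)
  \<comment> \<open>The factor \<open>f s\<close> passes through the linear map \<open>F'\<close>,
    so the same \<open>f\<close> serves at every time.\<close>
  have d\<gamma>_b: "vector_derivative (\<lambda>\<sigma>. \<gamma> \<sigma> t) (at s within I) = f s *\<^sub>R b (\<gamma> s t) t"
    if "s \<in> I" for s
  proof -
    have "vector_derivative (\<lambda>\<sigma>. \<gamma> \<sigma> t) (at s within I) = f s *\<^sub>R F' (\<gamma>0 s) (b (\<gamma>0 s) 0)"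
      using d\<gamma>[OF that] f(2)[OF that] linear_scale[OF has_derivative_linear[OF F']]
      by (simp add: assms(6))
    then show ?thesis
      using frozen_in_field[OF assms(1,2,7) t F'] by (simp add: assms(9))
  qed
  have "vector_derivative (\<lambda>\<sigma>. \<gamma> \<sigma> t) (at s within I) \<noteq> 0" if "s \<in> I" for s
    using diffeomorphism_derivative_inj[OF diffeo F'] nz[OF that] by (metis d\<gamma>[OF that])
  moreover have "smooth_on (\<lambda>s. \<gamma> s t) I"
    unfolding assms(9) using diffeo I(3) perfect
    by (intro smooth_on_compose[where F = "\<lambda>a. X a t"]) (auto simp: diffeomorphism_def)
  ultimately have "integral_curve (\<lambda>x. b x t) I (\<lambda>s. \<gamma> s t)"
    unfolding integral_curve_def using I(1,2) f(1) d\<gamma>_b by blast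
  moreover have "norm (b (\<gamma> s t) t) / norm (vector_derivative (\<lambda>\<sigma>. \<gamma> \<sigma> t) (at s within I))
      = norm (b0 (\<gamma>0 s)) / norm (vector_derivative \<gamma>0 (at s within I))" if s: "s \<in> I" for s
  proof -
    \<comment> \<open>The tangents are nonzero multiples of the fields, so neither field vanishes on
      its curve. Each quotient then genuinely cancels to \<open>1 / \<bar>f s\<bar>\<close>, with no
      division by zero involved.\<close>
    have "b (\<gamma> s t) t \<noteq> 0" "b0 (\<gamma>0 s) \<noteq> 0"
      using \<open>\<And>s. s \<in> I \<Longrightarrow> vector_derivative (\<lambda>\<sigma>. \<gamma> \<sigma> t) (at s within I) \<noteq> 0\<close>[OF s] d\<gamma>_b[OF s] nz[OF s] f(2)[OF s]
      by auto
    then show ?thesis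
      by (simp add: d\<gamma>_b[OF s] f(2)[OF s])
  qed
  ultimately show "integral_curve (\<lambda>x. b x t) I (\<lambda>s. \<gamma> s t) \<and>
    (\<forall>s\<in>I. norm (b (\<gamma> s t) t) / norm (vector_derivative (\<lambda>\<sigma>. \<gamma> \<sigma> t) (at s within I))
       = norm (b0 (\<gamma>0 s)) / norm (vector_derivative \<gamma>0 (at s within I)))"
    by blast
qed

end
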